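(* Let $T_n$ be an infinite model tree with branching numbers $n(r)$, $r\ge 0$. Then $T_n$ is stochastically complete if and only if $$\sum_{r=0}^\infty\frac{1}{n(r)}=\infty .$$
   Context: A model tree $T_n$ is an infinite, locally finite, connected tree containing a vertex $x_0$ (the root) such that the valence $m(x)$ of any other vertex $x$ depends only on the distance $r=d(x,x_0)$; write $m(x)=m(r)$ for $x\in S_r(x_0)=\{x: d(x,x_0)=r\}$. Its branching number is $n(0)=m(x_0)$ and $n(r)=m(r)-1$ for $r>0$, i.e. the number of edges leading from a vertex of $S_r(x_0)$ away from $x_0$. For an infinite, locally finite, connected graph $G$ with vertex set $V$, without loops or multiple edges: Laplacian: $\Delta f(x)=\sum_{y\sim x}(f(x)-f(y))$ for $f:V\to\mathbf{R}$. Heat kernel: fix a vertex $o\in V$. For $r\ge 0$ let $B_r$ be the subgraph induced on the vertices at distance at most $r$ from $o$; $\mathrm{int}\,B_r$ is the set of vertices of $B_r$ all of whose neighbors in $G$ lie in $B_r$, and $\partial B_r$ is the set of remaining vertices of $B_r$. Let $C(B_r,\partial B_r)$ be the finite-dimensional space of real functions on $B_r$ vanishing on $\partial B_r$, and let $\Delta_r$ act on it by $\Delta_r f(x)=\Delta f(x)$ for $x\in \mathrm{int}\,B_r$ and $\Delta_r f(x)=0$ for $x \in \partial B_r$. For $t\ge 0$ put $p_t^r(x,y)=e^{-t\Delta_r}\delta_x(y)$ for $x,y\in\mathrm{int}\,B_r$ and $p_t^r(x,y)=0$ for all other pairs of vertices. The heat kernel of $G$ is $p_t(x,y)=\lim_{r\to\infty}p_t^r(x,y)$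 (the limit exists and does not depend on $o$). Equivalently, $p_t(x,y)$ is the smallest non-negative function satisfying $\Delta p_t(x,y)+\frac{\partial}{\partial t}p_t(x,y)=0$ for $t \geq 0$ and $p_0(x,y)=\delta_x(y)$. One has $\sum_{y\in V}p_t(x,y)\le 1$. $G$ is stochastically incomplete if $\sum_{y\in V}p_t(x,y)<1$ for some $x\in V$ and some $t>0$; otherwise $G$ is stochastically complete. *)

theory Defs
  imports "HOL-Analysis.Analysis"
begin

text \<open>
  A graph is given by a vertex set and an adjacency relation; being symmetric and irreflexive, the
  relation encodes an undirected graph without loops or multiple edges.
\<close>

definition simple_graph :: "'a set \<Rightarrow> ('a \<Rightarrow> 'a \<Rightarrow> bool) \<Rightarrow> bool" where
  "simple_graph V E \<longleftrightarrow> symp E \<and> irreflp E \<and> (\<forall>x y. E x y \<longrightarrow> x \<in> V \<and> y \<in> V)"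

definition locally_finite_graph :: "'a set \<Rightarrow> ('a \<Rightarrow> 'a \<Rightarrow> bool) \<Rightarrow> bool" where
  "locally_finite_graph V E \<longleftrightarrow> (\<forall>x\<in>V. finite {y. E x y})"

definition connected_graph :: "'a set \<Rightarrow> ('a \<Rightarrow> 'a \<Rightarrow> bool) \<Rightarrow> bool" where
  "connected_graph V E \<longleftrightarrow> (\<forall>x\<in>V. \<forall>y\<in>V. E\<^sup>*\<^sup>* x y)"

definition graph_cycle :: "('a \<Rightarrow> 'a \<Rightarrow> bool) \<Rightarrow> 'a list \<Rightarrow> bool" where
  "graph_cycle E xs \<longleftrightarrow>
    3 \<le> length xs \<and> distinct xs \<and> successively E xs \<and> E (last xs) (hd xs)"

definition graph_tree :: "'a set \<Rightarrow> ('a \<Rightarrow> 'a \<Rightarrow> bool) \<Rightarrow> bool" where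
  "graph_tree V E \<longleftrightarrow> simple_graph V E \<and> connected_graph V E \<and> (\<nexists>xs. graph_cycle E xs)"

definition valence :: "('a \<Rightarrow> 'a \<Rightarrow> bool) \<Rightarrow> 'a \<Rightarrow> nat" where
  "valence E x = card {y. E x y}"

definition graph_dist :: "('a \<Rightarrow> 'a \<Rightarrow> bool) \<Rightarrow> 'a \<Rightarrow> 'a \<Rightarrow> nat" where
  "graph_dist E x y = (LEAST k. (E ^^ k) x y)"

text \<open>
  The valence function \<open>m\<close> is part of the data. At the root, the only vertex at distance 0,
  the last clause imposes no symmetry; it just says that \<open>m 0\<close> is the valence of the root.
\<close>

definition model_tree :: "'a set \<Rightarrow> ('a \<Rightarrow> 'a \<Rightarrow> bool) \<Rightarrow> 'a \<Rightarrow> (nat \<Rightarrow> nat) \<Rightarrow> bool" where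
  "model_tree V E x0 m \<longleftrightarrow>
    infinite V \<and> graph_tree V E \<and> locally_finite_graph V E \<and> x0 \<in> V \<and>
    (\<forall>x\<in>V. valence E x = m (graph_dist E x x0))"

text \<open>
  The subtraction does not truncate for a model tree: a vertex other than the root has a neighbour.
\<close>

definition branching_number :: "(nat \<Rightarrow> nat) \<Rightarrow> nat \<Rightarrow> nat" where
  "branching_number m r = (if r = 0 then m 0 else m r - 1)"

definition laplacian :: "('a \<Rightarrow> 'a \<Rightarrow> bool) \<Rightarrow> ('a \<Rightarrow> real) \<Rightarrow> 'a \<Rightarrow> real" where
  "laplacian E f x = (\<Sum>y\<in>{y. E x y}. f x - f y)"

definition graph_ball :: "'a set \<Rightarrow> ('a \<Rightarrow> 'a \<Rightarrow> bool) \<Rightarrow> 'a \<Rightarrow> nat \<Rightarrow> 'a set" where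
  "graph_ball V E b r = {x \<in> V. graph_dist E x b \<le> r}"

definition int_ball :: "'a set \<Rightarrow> ('a \<Rightarrow> 'a \<Rightarrow> bool) \<Rightarrow> 'a \<Rightarrow> nat \<Rightarrow> 'a set" where
  "int_ball V E b r = {x \<in> graph_ball V E b r. \<forall>y. E x y \<longrightarrow> y \<in> graph_ball V E b r}"

text \<open>
  Functions on a ball vanishing on its boundary are represented by their extension by 0, i.e. by
  functions vanishing outside the interior; the operator below maps these to themselves.
\<close>

definition dirichlet_laplacian ::
    "'a set \<Rightarrow> ('a \<Rightarrow> 'a \<Rightarrow> bool) \<Rightarrow> 'a \<Rightarrow> nat \<Rightarrow> ('a \<Rightarrow> real) \<Rightarrow> 'a \<Rightarrow> real" where
  "dirichlet_laplacian V E b r f x = (if x \<in> int_ball V E b r then laplacian E f x else 0)"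

text \<open>The operator exponential of \<open>- t\<close> times the Dirichlet Laplacian, as a power series.\<close>

definition dirichlet_semigroup ::
    "'a set \<Rightarrow> ('a \<Rightarrow> 'a \<Rightarrow> bool) \<Rightarrow> 'a \<Rightarrow> nat \<Rightarrow> real \<Rightarrow> ('a \<Rightarrow> real) \<Rightarrow> 'a \<Rightarrow> real" where
  "dirichlet_semigroup V E b r t f y =
    (\<Sum>k. (- t) ^ k / fact k * (dirichlet_laplacian V E b r ^^ k) f y)"

definition dirichlet_heat_kernel ::
    "'a set \<Rightarrow> ('a \<Rightarrow> 'a \<Rightarrow> bool) \<Rightarrow> 'a \<Rightarrow> nat \<Rightarrow> real \<Rightarrow> 'a \<Rightarrow> 'a \<Rightarrow> real" where
  "dirichlet_heat_kernel V E b r t x y =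
    (if x \<in> int_ball V E b r \<and> y \<in> int_ball V E b r
     then dirichlet_semigroup V E b r t (indicator {x}) y else 0)"

text \<open>
  The limit exists and is independent of the base point \<open>b\<close> of the exhaustion; here \<open>b\<close>
  is kept as a parameter.
\<close>

definition heat_kernel ::
    "'a set \<Rightarrow> ('a \<Rightarrow> 'a \<Rightarrow> bool) \<Rightarrow> 'a \<Rightarrow> real \<Rightarrow> 'a \<Rightarrow> 'a \<Rightarrow> real" where
  "heat_kernel V E b t x y = lim (\<lambda>r. dirichlet_heat_kernel V E b r t x y)"

text \<open>
  The heat kernel is non-negative with sums at most 1, so the unordered sum below converges and its
  default value 0 for divergent sums plays no role.
\<close>

definition stochastically_incomplete :: "'a set \<Rightarrow> ('a \<Rightarrow> 'a \<Rightarrow> bool) \<Rightarrow> 'a \<Rightarrow> bool" where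
  "stochastically_incomplete V E b \<longleftrightarrow>
    (\<exists>x\<in>V. \<exists>t>0. (\<Sum>\<^sub>\<infinity>y\<in>V. heat_kernel V E b t x y) < 1)"

definition stochastically_complete :: "'a set \<Rightarrow> ('a \<Rightarrow> 'a \<Rightarrow> bool) \<Rightarrow> 'a \<Rightarrow> bool" where
  "stochastically_complete V E b \<longleftrightarrow> \<not> stochastically_incomplete V E b"

end

theory Submission
  imports Defs
begin

text \<open>
  Stochastic completeness of a graph is governed by the positive solutions \<open>v\<close> of
  \<open>\<Delta> v = - v\<close>, where \<open>\<Delta>\<close> is the non-negative Laplacian. For such a \<open>v\<close> the function
  \<open>exp t * v x\<close> solves the heat equation, and it can be compared with the probability
  \<open>1 - u t x\<close> that heat started at \<open>x\<close> has left a large ball by time \<open>t\<close>: this probability solves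
  the heat equation inside the ball, is 0 there initially and is 1 on the boundary, and \<open>u t x\<close>
  increases with the ball to the total mass of the heat kernel at \<open>x\<close>.

  \<^item> If \<open>v\<close> tends to infinity and is at least \<open>c\<close> outside the ball, then
    \<open>1 - u t x \<le> exp t * v x / c\<close>. Letting the ball grow sends \<open>c\<close> to infinity, so no heat is lost
    (\<open>stochastically_complete_if_exhausting_supersolution\<close>).
  \<^item> If \<open>v \<le> 1\<close>, then \<open>exp t * v x - 1 \<le> exp T * (1 - u t x)\<close> for \<open>t \<le> T\<close>, whatever the ball. At
    \<open>t = T\<close> this reads \<open>u T x \<le> 1 - (v x - exp (- T))\<close>, and for large \<open>T\<close> heat has been lost
    (\<open>stochastically_incomplete_if_bounded_subsolution\<close>).

  Both comparisons are instances of the parabolic maximum principle on a finite set of vertices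
  (\<open>parabolic_maximum_principle\<close>, \<open>dirichlet_semigroup_comparison\<close>). The
  maximum principle applies to \<open>u\<close>, a sum of the Dirichlet heat kernel over its second argument,
  because \<open>u t\<close> is also the Dirichlet semigroup applied to the indicator of the interior of the ball
  (\<open>dirichlet_heat_kernel_sum\<close>).

  On a model tree a vertex of depth \<open>r > 0\<close> has one neighbour of depth \<open>r - 1\<close> and \<open>n r\<close> neighbours
  of depth \<open>r + 1\<close> (\<open>parent_unique\<close>, \<open>card_children\<close>), so that \<open>\<Delta> v = - v\<close> becomes a recursion for
  radial \<open>v\<close>:
  \<open>v (r + 1) - v r = (v r + (v r - v (r - 1))) / n r\<close> for \<open>r > 0\<close> and \<open>v 1 - v 0 = v 0 / n 0\<close>. The
  solution starting at 1 is increasing and satisfies \<open>1 / n r \<le> v (r + 1) - v r \<le> 2 * v r / n r\<close>. Hence it lies between the partial sums of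
  \<open>\<Sum>r. 1 / n r\<close> and the products of the factors \<open>1 + 2 / n r\<close>, and it is unbounded exactly when
  the series diverges.
\<close>

section \<open>The maximum principle\<close>

text \<open>
  Tilting \<open>w\<close> by \<open>- e * s\<close> keeps it positive somewhere if \<open>w\<close> is. At a maximum of the tilted function
  over space and time, the time is positive, the time derivative of \<open>w\<close> is at least \<open>e\<close>, and the
  Laplacian is non-negative because no neighbour has a larger value. This contradicts \<open>sub\<close>.
\<close>

lemma parabolic_maximum_principle:
  fixes w w' :: "real \<Rightarrow> 'a \<Rightarrow> real"
  assumes fin: "finite I"
    and deriv: "\<And>s x. x \<in> I \<Longrightarrow> 0 \<le> s \<Longrightarrow> s \<le> T \<Longrightarrow>
      ((\<lambda>s. w s x) has_real_derivative w' s x) (at s)"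
    and sub: "\<And>s x. x \<in> I \<Longrightarrow> 0 \<le> s \<Longrightarrow> s \<le> T \<Longrightarrow> w' s x + laplacian E (w s) x \<le> 0"
    and init: "\<And>x. x \<in> I \<Longrightarrow> w 0 x \<le> 0"
    and boundary: "\<And>s x y. x \<in> I \<Longrightarrow> E x y \<Longrightarrow> y \<notin> I \<Longrightarrow> 0 \<le> s \<Longrightarrow> s \<le> T \<Longrightarrow> w s y \<le> 0"
    and x: "x \<in> I" and t: "0 \<le> t" "t \<le> T"
  shows "w t x \<le> 0"
proof (rule ccontr)
  assume "\<not> w t x \<le> 0"
  then have pos: "w t x > 0" by simp
  define e where "e = w t x / (t + 1)"
  have e: "e > 0" using pos t by (simp add: e_def)
  have pos': "w t x - e * t > 0" using pos t by (simp add: e_def field_simps)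
  define h where "h s y = w s y - e * s" for s y
  \<comment> \<open>The maximum over space and time is taken first in time for each vertex, then over vertices.\<close>
  have "\<exists>s\<in>{0..T}. \<forall>s'\<in>{0..T}. h s' y \<le> h s y" if "y \<in> I" for y
  proof (rule continuous_attains_sup)
    show "compact {0..T}" "{0..T} \<noteq> {}" using t by auto
    show "continuous_on {0..T} (\<lambda>s. h s y)"
      unfolding h_def
      by (intro continuous_intros continuous_at_imp_continuous_on ballI DERIV_isCont)
         (use deriv[OF that] in auto)
  qed
  then obtain \<sigma> where \<sigma>: "\<And>y. y \<in> I \<Longrightarrow> \<sigma> y \<in> {0..T}"
    "\<And>y s'. y \<in> I \<Longrightarrow> s' \<in> {0..T} \<Longrightarrow> h s' y \<le> h (\<sigma> y) y" by metis
  obtain z where z: "z \<in> I" "\<And>y. y \<in> I \<Longrightarrow> h (\<sigma> y) y \<le> h (\<sigma> z) z"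
  proof -
    have "finite ((\<lambda>y. h (\<sigma> y) y) ` I)" "(\<lambda>y. h (\<sigma> y) y) ` I \<noteq> {}" using fin x by auto
    from Max_in[OF this] Max_ge[OF this(1)] show ?thesis using that by auto
  qed
  define s where "s = \<sigma> z"
  have s: "0 \<le> s" "s \<le> T" using \<sigma>(1)[OF z(1)] by (auto simp: s_def)
  have hmax: "h s' y \<le> h s z" if "y \<in> I" "0 \<le> s'" "s' \<le> T" for s' y
    using \<sigma>(2)[OF that(1), of s'] z(2)[OF that(1)] that by (force simp: s_def)
  have hpos: "h s z > 0" using hmax[OF x t] pos' by (simp add: h_def)
  then have wpos: "w s z > 0" using e s by (simp add: h_def) (smt (verit) mult_nonneg_nonneg)
  have "s \<noteq> 0" using init[OF z(1)] hpos by (auto simp: h_def)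
  then have "s > 0" using s by simp
  have d: "((\<lambda>s. h s z) has_real_derivative w' s z - e) (at s)"
    unfolding h_def using deriv[OF z(1) s] by (auto intro!: derivative_eq_intros)
  \<comment> \<open>The maximum may be attained at the final time, so only times before it are compared.\<close>
  have "w' s z - e \<ge> 0"
  proof (rule ccontr)
    assume "\<not> ?thesis"
    then have "w' s z - e < 0" by simp
    from DERIV_neg_dec_left[OF d this] obtain \<delta> where
      \<delta>: "\<delta> > 0" "\<And>k. k > 0 \<Longrightarrow> k < \<delta> \<Longrightarrow> h s z < h (s - k) z" by auto
    define k where "k = min (\<delta> / 2) s"
    have "k > 0" "k < \<delta>" "k \<le> s" using \<delta>(1) \<open>s > 0\<close> by (auto simp: k_def)
    then show False using \<delta>(2)[of k] hmax[OF z(1), of "s - k"] s by auto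
  qed
  moreover have "laplacian E (w s) z \<ge> 0"
    unfolding laplacian_def
  proof (intro sum_nonneg)
    fix y assume "y \<in> {y. E z y}"
    then have "E z y" by simp
    then show "0 \<le> w s z - w s y"
      using hmax[of y s] boundary[OF z(1) \<open>E z y\<close> _ s] s wpos by (cases "y \<in> I") (auto simp: h_def)
  qed
  ultimately show False using sub[OF z(1) s] e by simp
qed

section \<open>Distance and balls\<close>

locale lf_connected_graph =
  fixes V :: "'a set" and E :: "'a \<Rightarrow> 'a \<Rightarrow> bool"
  assumes simple: "simple_graph V E"
    and locally_finite: "locally_finite_graph V E"
    and connected: "connected_graph V E"
begin

lemma E_sym: "E x y \<Longrightarrow> E y x"
  using simple by (auto simp: simple_graph_def dest: sympD)

lemma E_irrefl: "\<not> E x x"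
  using simple by (auto simp: simple_graph_def irreflp_def)

lemma E_in_V: "E x y \<Longrightarrow> x \<in> V" "E x y \<Longrightarrow> y \<in> V"
  using simple by (auto simp: simple_graph_def)

lemma finite_neighbours: "finite {y. E x y}"
proof (cases "x \<in> V")
  case True
  then show ?thesis using locally_finite by (auto simp: locally_finite_graph_def)
next
  case False
  then have "{y. E x y} = {}" using E_in_V by auto
  then show ?thesis by simp
qed

lemma relpowp_graph_dist:
  assumes "x \<in> V" "y \<in> V"
  shows "(E ^^ graph_dist E x y) x y"
proof -
  have "E\<^sup>*\<^sup>* x y" using connected assms by (auto simp: connected_graph_def)
  then have "\<exists>k. (E ^^ k) x y" by (simp add: rtranclp_power)
  then show ?thesis unfolding graph_dist_def by (rule LeastI_ex)
qed

lemma graph_dist_le: "(E ^^ k) x y \<Longrightarrow> graph_dist E x y \<le> k"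
  unfolding graph_dist_def by (rule Least_le)

lemma graph_dist_neighbour_le:
  assumes "E x y" "z \<in> V"
  shows "graph_dist E x z \<le> Suc (graph_dist E y z)"
  using assms relpowp_graph_dist[of y z] E_in_V(2)[OF assms(1)]
  by (intro graph_dist_le relpowp_Suc_I2) auto

lemma graph_dist_self [simp]: "graph_dist E x x = 0"
  using graph_dist_le[of 0 x x] by simp

lemma graph_dist_eq_0:
  assumes "x \<in> V" "y \<in> V"
  shows "graph_dist E x y = 0 \<longleftrightarrow> x = y"
  using relpowp_graph_dist[OF assms] by auto

lemma closer_neighbour_exists:
  assumes "x \<in> V" "z \<in> V" "graph_dist E x z = Suc k"
  obtains y where "E x y" "graph_dist E y z = k"
proof -
  have "(E ^^ Suc k) x z" using relpowp_graph_dist[OF assms(1,2)] assms(3) by simp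
  then obtain y where y: "E x y" "(E ^^ k) y z" by (metis relpowp_Suc_D2)
  have "graph_dist E y z \<le> k" using graph_dist_le y by blast
  moreover have "Suc k \<le> Suc (graph_dist E y z)"
    using graph_dist_neighbour_le[OF y(1) assms(2)] assms(3) by simp
  ultimately show ?thesis using that y by auto
qed

lemma finite_graph_ball:
  assumes "b \<in> V"
  shows "finite (graph_ball V E b r)"
proof (induction r)
  case 0
  have "graph_ball V E b 0 \<subseteq> {b}" using graph_dist_eq_0 assms by (auto simp: graph_ball_def)
  then show ?case by (rule finite_subset) simp
next
  case (Suc r)
  have "graph_ball V E b (Suc r) \<subseteq>
      graph_ball V E b r \<union> (\<Union>y\<in>graph_ball V E b r. {x. E y x})"
  proof
    fix x assume x: "x \<in> graph_ball V E b (Suc r)"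
    show "x \<in> graph_ball V E b r \<union> (\<Union>y\<in>graph_ball V E b r. {x. E y x})"
    proof (cases "graph_dist E x b = Suc r")
      case True
      then obtain y where "E x y" "graph_dist E y b = r"
        using closer_neighbour_exists[of x b r] x assms by (auto simp: graph_ball_def)
      then have "y \<in> graph_ball V E b r" "E y x"
        using E_sym E_in_V(2) by (auto simp: graph_ball_def)
      then show ?thesis by blast
    qed (use x in \<open>auto simp: graph_ball_def\<close>)
  qed
  then show ?case by (rule finite_subset) (use Suc finite_neighbours in auto)
qed

lemma finite_int_ball: "b \<in> V \<Longrightarrow> finite (int_ball V E b r)"
  by (rule finite_subset[OF _ finite_graph_ball[of b r]]) (auto simp: int_ball_def)

lemma int_ball_subset: "int_ball V E b r \<subseteq> V"
  by (auto simp: int_ball_def graph_ball_def)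

lemma int_ball_in_V: "x \<in> int_ball V E b r \<Longrightarrow> x \<in> V"
  using int_ball_subset by auto

lemma int_ball_mono: "r \<le> s \<Longrightarrow> int_ball V E b r \<subseteq> int_ball V E b s"
  by (fastforce simp: int_ball_def graph_ball_def)

lemma in_int_ball:
  assumes "x \<in> V" "b \<in> V" "Suc (graph_dist E x b) \<le> r"
  shows "x \<in> int_ball V E b r"
proof -
  have "y \<in> graph_ball V E b r" if "E x y" for y
    using graph_dist_neighbour_le[OF E_sym[OF that] assms(2)] assms E_in_V[OF that]
    by (auto simp: graph_ball_def)
  then show ?thesis using assms by (auto simp: int_ball_def graph_ball_def)
qed

lemma finite_subset_int_ball:
  assumes "finite F" "F \<subseteq> V" "b \<in> V"
  obtains r where "F \<subseteq> int_ball V E b r"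
proof -
  obtain N where "\<forall>k\<in>(\<lambda>x. graph_dist E x b) ` F. k \<le> N"
    using finite_nat_set_iff_bounded_le assms(1) by (meson finite_imageI)
  then have "F \<subseteq> int_ball V E b (Suc N)" using assms in_int_ball by auto
  then show ?thesis using that by blast
qed

section \<open>The Dirichlet semigroup\<close>

lemma laplacian_scale: "laplacian E (\<lambda>z. c * f z) x = c * laplacian E f x"
  by (simp add: laplacian_def sum_distrib_left right_diff_distrib)

lemma laplacian_diff: "laplacian E (\<lambda>z. f z - g z) x = laplacian E f x - laplacian E g x"
  by (simp add: laplacian_def sum_subtractf[symmetric] algebra_simps)

lemma laplacian_const: "laplacian E (\<lambda>z. c) x = 0"
  by (simp add: laplacian_def)

lemma abs_laplacian_le:
  assumes "\<And>x. \<bar>f x\<bar> \<le> M"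
  shows "\<bar>laplacian E f x\<bar> \<le> real (valence E x) * (2 * M)"
proof -
  have "\<bar>f x - f y\<bar> \<le> 2 * M" for y using assms[of x] assms[of y] by linarith
  then have "(\<Sum>y\<in>{y. E x y}. \<bar>f x - f y\<bar>) \<le> real (card {y. E x y}) * (2 * M)"
    by (intro sum_bounded_above) auto
  then show ?thesis unfolding laplacian_def valence_def using sum_abs order_trans by metis
qed

text \<open>
  The Dirichlet Laplacian is a bounded operator since only finitely many valences are involved. The
  geometric bound makes the exponential series and its term-by-term derivative converge.
\<close>

lemma dirichlet_powers_bounded:
  assumes "b \<in> V" "\<And>x. \<bar>f x\<bar> \<le> M"
  shows "\<exists>C. \<forall>k x. \<bar>(dirichlet_laplacian V E b r ^^ k) f x\<bar> \<le> C ^ k * M"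
proof -
  define C where "C = 2 * real (\<Sum>x\<in>int_ball V E b r. valence E x)"
  have "M \<ge> 0" using assms(2)[of undefined] by linarith
  have "C \<ge> 0" by (simp add: C_def sum_nonneg)
  have "\<bar>(dirichlet_laplacian V E b r ^^ k) f x\<bar> \<le> C ^ k * M" for k x
  proof (induction k arbitrary: x)
    case (Suc k)
    let ?g = "(dirichlet_laplacian V E b r ^^ k) f"
    show ?case
    proof (cases "x \<in> int_ball V E b r")
      case True
      have "valence E x \<le> (\<Sum>x\<in>int_ball V E b r. valence E x)"
        using True finite_int_ball[OF assms(1)] by (intro member_le_sum) auto
      then have "2 * real (valence E x) \<le> C" unfolding C_def by linarith
      then have "2 * real (valence E x) * (C ^ k * M) \<le> C * (C ^ k * M)"
        using \<open>M \<ge> 0\<close> \<open>C \<ge> 0\<close> by (intro mult_right_mono) auto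
      moreover have "\<bar>laplacian E ?g x\<bar> \<le> real (valence E x) * (2 * (C ^ k * M))"
        by (rule abs_laplacian_le) (rule Suc)
      moreover have "(dirichlet_laplacian V E b r ^^ Suc k) f x = laplacian E ?g x"
        using True by (simp add: dirichlet_laplacian_def[of V E b r _ x])
      ultimately show ?thesis by (simp add: mult_ac)
    qed (use \<open>M \<ge> 0\<close> \<open>C \<ge> 0\<close> in \<open>auto simp: dirichlet_laplacian_def\<close>)
  qed (use assms in auto)
  then show ?thesis by blast
qed

lemma dirichlet_series_summable:
  assumes "b \<in> V" "\<And>x. \<bar>f x\<bar> \<le> M"
  shows "summable (\<lambda>k. (- t) ^ k / fact k * (dirichlet_laplacian V E b r ^^ k) f y)"
proof -
  obtain C where C: "\<And>k x. \<bar>(dirichlet_laplacian V E b r ^^ k) f x\<bar> \<le> C ^ k * M"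
    using dirichlet_powers_bounded[where f = f and r = r, OF assms] by blast
  have "summable (\<lambda>k. inverse (fact k) * (\<bar>t\<bar> * C) ^ k * M)"
    by (rule summable_mult2, rule summable_exp)
  then show ?thesis
  proof (rule summable_comparison_test')
    fix k :: nat
    have "\<bar>t\<bar> ^ k / fact k * \<bar>(dirichlet_laplacian V E b r ^^ k) f y\<bar> \<le> \<bar>t\<bar> ^ k / fact k * (C ^ k * M)"
      by (intro mult_left_mono C) auto
    then show "norm ((- t) ^ k / fact k * (dirichlet_laplacian V E b r ^^ k) f y)
        \<le> inverse (fact k) * (\<bar>t\<bar> * C) ^ k * M"
      by (simp add: abs_mult power_abs power_mult_distrib field_simps)
  qed
qed

lemma dirichlet_semigroup_sums:
  assumes "b \<in> V" "\<And>x. \<bar>f x\<bar> \<le> M"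
  shows "(\<lambda>k. (- t) ^ k / fact k * (dirichlet_laplacian V E b r ^^ k) f y)
    sums dirichlet_semigroup V E b r t f y"
  unfolding dirichlet_semigroup_def by (intro summable_sums dirichlet_series_summable[OF assms])

lemma dirichlet_semigroup_has_derivative:
  assumes "b \<in> V" "\<And>x. \<bar>f x\<bar> \<le> M"
  shows "((\<lambda>t. dirichlet_semigroup V E b r t f y) has_real_derivative
    - dirichlet_laplacian V E b r (dirichlet_semigroup V E b r t f) y) (at t)"
proof -
  let ?L = "dirichlet_laplacian V E b r"
  define c where "c k = (- 1) ^ k / fact k * (?L ^^ k) f y" for k
  have ck: "c k * s ^ k = (- s) ^ k / fact k * (?L ^^ k) f y" for k s
    using power_mult_distrib[of "-1" s k] by (simp add: c_def)
  have "((\<lambda>s. \<Sum>k. c k * s ^ k) has_real_derivative (\<Sum>k. diffs c k * t ^ k)) (at t)"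
    by (rule termdiffs_strong_converges_everywhere)
       (use dirichlet_series_summable[OF assms] in \<open>simp add: ck\<close>)
  moreover have "(\<lambda>s. \<Sum>k. c k * s ^ k) = (\<lambda>s. dirichlet_semigroup V E b r s f y)"
    by (simp add: ck dirichlet_semigroup_def)
  moreover have "(\<lambda>k. diffs c k * t ^ k) sums
      (- ?L (dirichlet_semigroup V E b r t f) y)"
  proof -
    have "(\<lambda>k. ?L (\<lambda>z. (- t) ^ k / fact k * (?L ^^ k) f z) y) sums
        ?L (dirichlet_semigroup V E b r t f) y"
    proof (cases "y \<in> int_ball V E b r")
      case True
      have "(\<lambda>k. laplacian E (\<lambda>z. (- t) ^ k / fact k * (?L ^^ k) f z) y) sums
          laplacian E (dirichlet_semigroup V E b r t f) y"
        unfolding laplacian_def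
        by (rule sums_sum, rule sums_diff) (rule dirichlet_semigroup_sums[OF assms])+
      then show ?thesis using True by (simp add: dirichlet_laplacian_def[of V E b r _ y])
    qed (auto simp: dirichlet_laplacian_def)
    then have "(\<lambda>k. - ?L (\<lambda>z. (- t) ^ k / fact k * (?L ^^ k) f z) y) sums
        (- ?L (dirichlet_semigroup V E b r t f) y)" by (rule sums_minus)
    moreover have "- ?L (\<lambda>z. (- t) ^ k / fact k * (?L ^^ k) f z) y = diffs c k * t ^ k" for k
    proof -
      define X where "X = ?L ((?L ^^ k) f) y"
      have "(- t) ^ k = (- 1) ^ k * t ^ k" using power_mult_distrib[of "-1" t k] by simp
      then have "?L (\<lambda>z. (- t) ^ k / fact k * (?L ^^ k) f z) y = (- 1) ^ k * t ^ k / fact k * X"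
        by (simp only: dirichlet_laplacian_def[of V E b r _ y] laplacian_scale X_def) auto
      moreover have "c (Suc k) = (- 1) ^ Suc k / fact (Suc k) * X" by (simp add: c_def X_def)
      moreover have "inverse (fact k) = real (Suc k) * inverse (fact (Suc k))"
        by (simp del: of_nat_Suc)
      ultimately show ?thesis
        by (simp only: diffs_def divide_inverse) (simp add: mult_ac del: fact_Suc of_nat_Suc)
    qed
    ultimately show ?thesis by simp
  qed
  ultimately show ?thesis by (simp add: sums_iff)
qed

lemma dirichlet_semigroup_0: "dirichlet_semigroup V E b r 0 f y = f y"
proof -
  have "(\<lambda>k. (- 0) ^ k / fact k * (dirichlet_laplacian V E b r ^^ k) f y) sums
      (\<Sum>k\<in>{0}. (- 0) ^ k / fact k * (dirichlet_laplacian V E b r ^^ k) f y)"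
    by (rule sums_finite) (auto simp: power_0_left)
  then show ?thesis by (simp add: dirichlet_semigroup_def sums_iff)
qed

lemma dirichlet_semigroup_outside:
  assumes "y \<notin> int_ball V E b r" "f y = 0"
  shows "dirichlet_semigroup V E b r t f y = 0"
proof -
  have "(dirichlet_laplacian V E b r ^^ k) f y = 0" for k
    using assms by (cases k) (auto simp: dirichlet_laplacian_def)
  then show ?thesis by (simp add: dirichlet_semigroup_def)
qed

lemma dirichlet_powers_outside:
  assumes "\<And>y. y \<notin> int_ball V E b r \<Longrightarrow> f y = 0" "y \<notin> int_ball V E b r"
  shows "(dirichlet_laplacian V E b r ^^ k) f y = 0"
  using assms by (cases k) (auto simp: dirichlet_laplacian_def)

text \<open>
  On functions vanishing off the interior, the Laplacian is multiplication by the valence minus the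
  adjacency matrix of the interior, and that matrix is symmetric.
\<close>

lemma dirichlet_laplacian_self_adjoint:
  assumes "b \<in> V"
    and f: "\<And>y. y \<notin> int_ball V E b r \<Longrightarrow> f y = 0"
    and g: "\<And>y. y \<notin> int_ball V E b r \<Longrightarrow> g y = 0"
  shows "(\<Sum>x\<in>int_ball V E b r. dirichlet_laplacian V E b r f x * g x) =
    (\<Sum>x\<in>int_ball V E b r. f x * dirichlet_laplacian V E b r g x)"
proof -
  let ?I = "int_ball V E b r"
  have fin: "finite ?I" using finite_int_ball assms(1) .
  have lap: "laplacian E h x = real (valence E x) * h x - (\<Sum>y\<in>?I. if E x y then h y else 0)"
    if "\<And>y. y \<notin> ?I \<Longrightarrow> h y = 0" for h x
  proof -
    have "(\<Sum>y\<in>{y. E x y}. h y) = (\<Sum>y\<in>{y\<in>?I. E x y}. h y)"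
      using finite_neighbours that by (intro sum.mono_neutral_right) auto
    also have "\<dots> = (\<Sum>y\<in>?I. if E x y then h y else 0)"
      using fin by (simp add: sum.inter_filter)
    finally show ?thesis by (simp add: laplacian_def sum_subtractf valence_def)
  qed
  have "(\<Sum>x\<in>?I. (\<Sum>y\<in>?I. if E x y then f y else 0) * g x) =
      (\<Sum>x\<in>?I. \<Sum>y\<in>?I. if E x y then f y * g x else 0)"
    by (auto simp: sum_distrib_right intro!: sum.cong)
  also have "\<dots> = (\<Sum>y\<in>?I. \<Sum>x\<in>?I. if E x y then f y * g x else 0)"
    by (rule sum.swap)
  also have "\<dots> = (\<Sum>y\<in>?I. f y * (\<Sum>x\<in>?I. if E y x then g x else 0))"
    unfolding sum_distrib_left using E_sym by (intro sum.cong) auto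
  finally show ?thesis
    by (simp add: dirichlet_laplacian_def lap[OF f] lap[OF g] left_diff_distrib right_diff_distrib
        sum_subtractf mult_ac)
qed

lemma dirichlet_powers_self_adjoint:
  assumes "b \<in> V"
    and f: "\<And>y. y \<notin> int_ball V E b r \<Longrightarrow> f y = 0"
    and g: "\<And>y. y \<notin> int_ball V E b r \<Longrightarrow> g y = 0"
  shows "(\<Sum>x\<in>int_ball V E b r. (dirichlet_laplacian V E b r ^^ k) f x * g x) =
    (\<Sum>x\<in>int_ball V E b r. f x * (dirichlet_laplacian V E b r ^^ k) g x)"
  using g
proof (induction k arbitrary: g)
  case (Suc k)
  let ?L = "dirichlet_laplacian V E b r"
  have "(\<Sum>x\<in>int_ball V E b r. (?L ^^ Suc k) f x * g x) =
      (\<Sum>x\<in>int_ball V E b r. (?L ^^ k) f x * ?L g x)"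
    using dirichlet_laplacian_self_adjoint[OF assms(1) dirichlet_powers_outside[OF f] Suc.prems]
    by simp
  also have "\<dots> = (\<Sum>x\<in>int_ball V E b r. f x * (?L ^^ k) (?L g) x)"
    by (rule Suc.IH) (auto simp: dirichlet_laplacian_def)
  also have "(?L ^^ k) (?L g) = (?L ^^ Suc k) g" by (simp add: funpow_swap1)
  finally show ?case .
qed simp

lemma dirichlet_heat_kernel_eq:
  "dirichlet_heat_kernel V E b r t x y =
    (if x \<in> int_ball V E b r then dirichlet_semigroup V E b r t (indicator {x}) y else 0)"
  using dirichlet_semigroup_outside[of y b r "indicator {x}" t]
  by (auto simp: dirichlet_heat_kernel_def indicator_def)

text \<open>
  The kernel at \<open>x\<close> evolves the point mass at \<open>x\<close> and is summed over its endpoint. Self-adjointness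
  moves the evolution to the other factor, the indicator of the interior. The mass thus becomes a
  solution of the heat equation in the starting point \<open>x\<close>, to which the maximum principle applies.
\<close>

lemma dirichlet_heat_kernel_sum:
  assumes "b \<in> V" "x \<in> int_ball V E b r"
  shows "(\<Sum>y\<in>int_ball V E b r. dirichlet_heat_kernel V E b r t x y) =
    dirichlet_semigroup V E b r t (indicator (int_ball V E b r)) x"
proof -
  let ?I = "int_ball V E b r" and ?L = "dirichlet_laplacian V E b r"
  have "(\<lambda>k. \<Sum>y\<in>?I. (- t) ^ k / fact k * (?L ^^ k) (indicator {x}) y) sums
      (\<Sum>y\<in>?I. dirichlet_semigroup V E b r t (indicator {x}) y)"
    by (rule sums_sum, rule dirichlet_semigroup_sums[OF assms(1), where M = 1])
       (auto simp: indicator_def)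
  moreover have "(\<Sum>y\<in>?I. (- t) ^ k / fact k * (?L ^^ k) (indicator {x}) y) =
      (- t) ^ k / fact k * (?L ^^ k) (indicator ?I) x" for k
  proof -
    have "(\<Sum>y\<in>?I. (?L ^^ k) (indicator {x}) y) = (\<Sum>y\<in>?I. (?L ^^ k) (indicator {x}) y * indicator ?I y)"
      by (intro sum.cong) auto
    also have "\<dots> = (\<Sum>y\<in>?I. indicator {x} y * (?L ^^ k) (indicator ?I) y)"
      using assms by (intro dirichlet_powers_self_adjoint) (auto simp: indicator_def)
    also have "\<dots> = (?L ^^ k) (indicator ?I) x"
      using assms finite_int_ball[OF assms(1)] by (simp add: indicator_def if_distrib if_distribR cong: if_cong)
    finally have "(\<Sum>y\<in>?I. (?L ^^ k) (indicator {x}) y) = (?L ^^ k) (indicator ?I) x" .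
    then show ?thesis by (simp only: sum_distrib_left[symmetric])
  qed
  ultimately have "(\<Sum>y\<in>?I. dirichlet_semigroup V E b r t (indicator {x}) y) =
      dirichlet_semigroup V E b r t (indicator ?I) x"
    by (simp add: dirichlet_semigroup_def sums_iff)
  then show ?thesis using assms by (simp add: dirichlet_heat_kernel_eq)
qed

text \<open>
  The maximum principle for \<open>c\<close> times the semigroup minus a supersolution \<open>h\<close>. The factor \<open>c\<close> has
  arbitrary sign, so that lower bounds on the semigroup are covered as well.
\<close>

lemma dirichlet_semigroup_comparison:
  assumes "b \<in> V"
    and f: "\<And>x. \<bar>f x\<bar> \<le> M" "\<And>y. y \<notin> int_ball V E b r \<Longrightarrow> f y = 0"
    and deriv: "\<And>s x. x \<in> int_ball V E b r \<Longrightarrow> 0 \<le> s \<Longrightarrow>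
      ((\<lambda>s. h s x) has_real_derivative h' s x) (at s)"
    and super: "\<And>s x. x \<in> int_ball V E b r \<Longrightarrow> 0 \<le> s \<Longrightarrow> 0 \<le> h' s x + laplacian E (h s) x"
    and init: "\<And>x. x \<in> int_ball V E b r \<Longrightarrow> c * f x \<le> h 0 x"
    and boundary: "\<And>s y. y \<in> V \<Longrightarrow> y \<notin> int_ball V E b r \<Longrightarrow> 0 \<le> s \<Longrightarrow> s \<le> t \<Longrightarrow> 0 \<le> h s y"
    and "x \<in> V" "0 \<le> t"
  shows "c * dirichlet_semigroup V E b r t f x \<le> h t x"
proof (cases "x \<in> int_ball V E b r")
  case True
  define S where "S s = dirichlet_semigroup V E b r s f" for s
  define w where "w s y = c * S s y - h s y" for s y
  define w' where "w' s y = c * (- laplacian E (S s) y) - h' s y" for s y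
  have "w t x \<le> 0"
  proof (rule parabolic_maximum_principle[where w = w and w' = w' and I = "int_ball V E b r" and T = t])
    show "finite (int_ball V E b r)" using finite_int_ball assms(1) .
    fix s :: real and y assume y: "y \<in> int_ball V E b r" and s: "0 \<le> s"
    have "((\<lambda>s. S s y) has_real_derivative - laplacian E (S s) y) (at s)"
      using dirichlet_semigroup_has_derivative[where f = f and r = r and t = s and y = y,
          OF assms(1) f(1)] y
      by (simp add: S_def dirichlet_laplacian_def)
    then show "((\<lambda>s. w s y) has_real_derivative w' s y) (at s)"
      unfolding w_def w'_def by (intro DERIV_diff DERIV_cmult deriv y s)
    show "w' s y + laplacian E (w s) y \<le> 0"
      using super[OF y s] unfolding w_def w'_def laplacian_diff laplacian_scale by simp
  next
    fix y assume "y \<in> int_ball V E b r"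
    then show "w 0 y \<le> 0" using init by (simp add: w_def S_def dirichlet_semigroup_0)
  next
    fix s :: real and z y assume "E z y" "y \<notin> int_ball V E b r" "0 \<le> s" "s \<le> t"
    then show "w s y \<le> 0"
      using boundary[of y s] E_in_V f(2) by (simp add: w_def S_def dirichlet_semigroup_outside)
  qed (use True assms in auto)
  then show ?thesis by (simp add: w_def S_def)
next
  case False
  then show ?thesis
    using boundary[of x t] assms by (simp add: dirichlet_semigroup_outside)
qed

lemma dirichlet_semigroup_nonneg:
  assumes "b \<in> V" "\<And>x. \<bar>f x\<bar> \<le> M" "\<And>y. y \<notin> int_ball V E b r \<Longrightarrow> f y = 0"
    and "\<And>x. 0 \<le> f x" "x \<in> V" "0 \<le> t"
  shows "0 \<le> dirichlet_semigroup V E b r t f x"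
proof -
  have "(- 1) * dirichlet_semigroup V E b r t f x \<le> 0"
    by (rule dirichlet_semigroup_comparison[where h = "\<lambda>_ _. 0" and h' = "\<lambda>_ _. 0", OF assms(1-3)])
       (use assms in \<open>auto simp: laplacian_const\<close>)
  then show ?thesis by simp
qed

section \<open>The heat kernel as a monotone limit\<close>

lemma dirichlet_heat_kernel_nonneg:
  assumes "b \<in> V" "y \<in> V" "0 \<le> t"
  shows "0 \<le> dirichlet_heat_kernel V E b r t x y"
  unfolding dirichlet_heat_kernel_eq using assms
  by (auto intro!: dirichlet_semigroup_nonneg[where M = 1] simp: indicator_def)

text \<open>
  The kernel of the larger ball solves the heat equation in the smaller one and is non-negative where
  the kernel of the smaller ball vanishes.
\<close>

lemma incseq_dirichlet_heat_kernel:
  assumes "b \<in> V" "y \<in> V" "0 \<le> t"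
  shows "incseq (\<lambda>r. dirichlet_heat_kernel V E b r t x y)"
proof (rule incseq_SucI)
  fix r
  show "dirichlet_heat_kernel V E b r t x y \<le> dirichlet_heat_kernel V E b (Suc r) t x y"
  proof (cases "x \<in> int_ball V E b r")
    case True
    have sub: "int_ball V E b r \<subseteq> int_ball V E b (Suc r)" by (rule int_ball_mono) simp
    let ?f = "indicator {x} :: 'a \<Rightarrow> real"
    have f: "\<And>x. \<bar>?f x\<bar> \<le> 1" by (auto simp: indicator_def)
    have "1 * dirichlet_semigroup V E b r t ?f y \<le> dirichlet_semigroup V E b (Suc r) t ?f y"
    proof (rule dirichlet_semigroup_comparison
        [where h' = "\<lambda>s y. - laplacian E (dirichlet_semigroup V E b (Suc r) s ?f) y", OF assms(1) f])
      fix s :: real and z assume "z \<in> int_ball V E b r"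
      then show "((\<lambda>s. dirichlet_semigroup V E b (Suc r) s ?f z) has_real_derivative
          - laplacian E (dirichlet_semigroup V E b (Suc r) s ?f) z) (at s)"
        using dirichlet_semigroup_has_derivative[where f = ?f and r = "Suc r" and t = s and y = z,
            OF assms(1) f] sub
        by (auto simp: dirichlet_laplacian_def)
    next
      fix s :: real and z assume "z \<in> V" "0 \<le> s"
      then show "0 \<le> dirichlet_semigroup V E b (Suc r) s ?f z"
        using True sub by (intro dirichlet_semigroup_nonneg[OF assms(1) f]) (auto simp: indicator_def)
    qed (use True assms in \<open>auto simp: dirichlet_semigroup_0 indicator_eq_0_iff\<close>)
    then show ?thesis using True sub by (auto simp: dirichlet_heat_kernel_eq)
  next
    case False
    then show ?thesis
      using dirichlet_heat_kernel_nonneg[OF assms, of "Suc r" x] by (simp add: dirichlet_heat_kernel_eq)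
  qed
qed

lemma dirichlet_semigroup_indicator_le_1:
  assumes "b \<in> V" "0 \<le> t" "x \<in> int_ball V E b r"
  shows "dirichlet_semigroup V E b r t (indicator (int_ball V E b r)) x \<le> 1"
proof -
  have "1 * dirichlet_semigroup V E b r t (indicator (int_ball V E b r)) x \<le> 1"
    by (rule dirichlet_semigroup_comparison
        [where h = "\<lambda>_ _. 1" and h' = "\<lambda>_ _. 0" and M = 1, OF assms(1)])
       (use assms int_ball_subset in \<open>auto simp: laplacian_const indicator_def\<close>)
  then show ?thesis by simp
qed

lemma dirichlet_heat_kernel_le_1:
  assumes "b \<in> V" "0 \<le> t"
  shows "dirichlet_heat_kernel V E b r t x y \<le> 1"
proof (cases "x \<in> int_ball V E b r \<and> y \<in> int_ball V E b r")
  case True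
  have "dirichlet_heat_kernel V E b r t x y \<le>
      (\<Sum>y\<in>int_ball V E b r. dirichlet_heat_kernel V E b r t x y)"
    using True assms finite_int_ball
    by (intro member_le_sum) (auto intro!: dirichlet_heat_kernel_nonneg dest: int_ball_in_V)
  also have "\<dots> \<le> 1"
    using True assms by (simp add: dirichlet_heat_kernel_sum dirichlet_semigroup_indicator_le_1)
  finally show ?thesis .
qed (auto simp: dirichlet_heat_kernel_def)

lemma dirichlet_heat_kernel_tendsto:
  assumes "b \<in> V" "y \<in> V" "0 \<le> t"
  shows "(\<lambda>r. dirichlet_heat_kernel V E b r t x y) \<longlonglongrightarrow> heat_kernel V E b t x y"
proof -
  have "convergent (\<lambda>r. dirichlet_heat_kernel V E b r t x y)"
    using incseq_convergent[OF incseq_dirichlet_heat_kernel[OF assms]]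
      dirichlet_heat_kernel_le_1[OF assms(1,3)] unfolding convergent_def by metis
  then show ?thesis by (simp add: heat_kernel_def convergent_LIMSEQ_iff)
qed

lemma dirichlet_heat_kernel_le_heat_kernel:
  assumes "b \<in> V" "y \<in> V" "0 \<le> t"
  shows "dirichlet_heat_kernel V E b r t x y \<le> heat_kernel V E b t x y"
  by (rule incseq_le[OF incseq_dirichlet_heat_kernel[OF assms] dirichlet_heat_kernel_tendsto[OF assms]])

lemma heat_kernel_nonneg:
  assumes "b \<in> V" "y \<in> V" "0 \<le> t"
  shows "0 \<le> heat_kernel V E b t x y"
  by (rule order_trans[OF dirichlet_heat_kernel_nonneg[OF assms, of 0]
        dirichlet_heat_kernel_le_heat_kernel[OF assms]])

text \<open>
  A finite sum commutes with the limit in the radius, and for each radius it is at most the total mass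
  of the Dirichlet heat kernel. A starting vertex outside the interior has mass 0, hence \<open>0 \<le> c\<close>.
\<close>

lemma heat_kernel_finite_sum_le:
  assumes "b \<in> V" "0 \<le> t" "finite F" "F \<subseteq> V" "0 \<le> c"
    and bound: "\<And>r. x \<in> int_ball V E b r \<Longrightarrow>
      dirichlet_semigroup V E b r t (indicator (int_ball V E b r)) x \<le> c"
  shows "(\<Sum>y\<in>F. heat_kernel V E b t x y) \<le> c"
proof (rule LIMSEQ_le_const2)
  show "(\<lambda>r. \<Sum>y\<in>F. dirichlet_heat_kernel V E b r t x y) \<longlonglongrightarrow> (\<Sum>y\<in>F. heat_kernel V E b t x y)"
    using assms by (intro tendsto_sum dirichlet_heat_kernel_tendsto) auto
  have "(\<Sum>y\<in>F. dirichlet_heat_kernel V E b r t x y) \<le> c" for r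
  proof (cases "x \<in> int_ball V E b r")
    case True
    have "(\<Sum>y\<in>F. dirichlet_heat_kernel V E b r t x y) \<le>
        (\<Sum>y\<in>F \<union> int_ball V E b r. dirichlet_heat_kernel V E b r t x y)"
      using assms finite_int_ball
      by (intro sum_mono2) (auto intro!: dirichlet_heat_kernel_nonneg dest: int_ball_in_V)
    also have "\<dots> = (\<Sum>y\<in>int_ball V E b r. dirichlet_heat_kernel V E b r t x y)"
      using assms finite_int_ball
      by (intro sum.mono_neutral_right) (auto simp: dirichlet_heat_kernel_def)
    also have "\<dots> \<le> c" using bound[OF True] dirichlet_heat_kernel_sum[OF assms(1) True] by simp
    finally show ?thesis .
  next
    case False
    then show ?thesis using assms by (simp add: dirichlet_heat_kernel_def)
  qed
  then show "\<exists>N. \<forall>r\<ge>N. (\<Sum>y\<in>F. dirichlet_heat_kernel V E b r t x y) \<le> c" by blast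
qed

lemma heat_kernel_summable:
  assumes "b \<in> V" "0 \<le> t"
  shows "heat_kernel V E b t x summable_on V"
proof (rule nonneg_bdd_above_summable_on)
  show "bdd_above (sum (heat_kernel V E b t x) ` {F. F \<subseteq> V \<and> finite F})"
    using heat_kernel_finite_sum_le[OF assms, where c = 1] dirichlet_semigroup_indicator_le_1[OF assms]
    by (intro bdd_aboveI[where M = 1]) auto
qed (use heat_kernel_nonneg assms in auto)

lemma heat_kernel_mass_le:
  assumes "b \<in> V" "0 \<le> t" "0 \<le> c"
    and "\<And>r. x \<in> int_ball V E b r \<Longrightarrow>
      dirichlet_semigroup V E b r t (indicator (int_ball V E b r)) x \<le> c"
  shows "(\<Sum>\<^sub>\<infinity>y\<in>V. heat_kernel V E b t x y) \<le> c"
  using heat_kernel_finite_sum_le[OF assms(1,2) _ _ assms(3,4)]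
  by (intro infsum_le_finite_sums heat_kernel_summable assms) auto

lemma heat_kernel_mass_ge:
  assumes "b \<in> V" "0 \<le> t" "x \<in> int_ball V E b r"
  shows "dirichlet_semigroup V E b r t (indicator (int_ball V E b r)) x
    \<le> (\<Sum>\<^sub>\<infinity>y\<in>V. heat_kernel V E b t x y)"
proof -
  have "dirichlet_semigroup V E b r t (indicator (int_ball V E b r)) x
      \<le> (\<Sum>y\<in>int_ball V E b r. heat_kernel V E b t x y)"
    using assms int_ball_subset
    by (auto simp: dirichlet_heat_kernel_sum[symmetric] intro!: sum_mono dirichlet_heat_kernel_le_heat_kernel)
  also have "\<dots> \<le> (\<Sum>\<^sub>\<infinity>y\<in>V. heat_kernel V E b t x y)"
    using assms int_ball_subset finite_int_ball heat_kernel_nonneg heat_kernel_summable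
    by (intro finite_sum_le_infsum) auto
  finally show ?thesis .
qed

section \<open>Criteria for stochastic completeness and incompleteness\<close>

text \<open>
  Khas'minskii's criterion. In a ball containing the sublevel set of \<open>c\<close>, the supersolution
  \<open>exp t * v x / c\<close> of the heat equation is at least 1 outside the interior, so it dominates the heat
  lost; \<open>c\<close> is arbitrary.
\<close>

lemma stochastically_complete_if_exhausting_supersolution:
  assumes b: "b \<in> V"
    and v: "\<And>x. x \<in> V \<Longrightarrow> 0 \<le> v x" "\<And>x. x \<in> V \<Longrightarrow> 0 \<le> v x + laplacian E v x"
    and sublevel: "\<And>c. finite {x \<in> V. v x < c}"
  shows "stochastically_complete V E b"
  unfolding stochastically_complete_def stochastically_incomplete_def
proof (rule notI, elim bexE exE conjE)
  fix x t assume x: "x \<in> V" and t: "(0::real) < t"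
  define A where "A = (\<Sum>\<^sub>\<infinity>y\<in>V. heat_kernel V E b t x y)"
  assume "(\<Sum>\<^sub>\<infinity>y\<in>V. heat_kernel V E b t x y) < 1"
  then have A: "A < 1" by (simp add: A_def)
  have ge: "1 - exp t * v x / c \<le> A" if c: "c > 0" for c
  proof -
    have "finite (insert x {x \<in> V. v x < c})" using sublevel by simp
    then obtain r where r: "insert x {x \<in> V. v x < c} \<subseteq> int_ball V E b r"
      using finite_subset_int_ball[of "insert x {x \<in> V. v x < c}" b] b x by auto
    let ?I = "int_ball V E b r"
    have inV: "y \<in> V" if "y \<in> ?I" for y using that int_ball_subset by auto
    have "(- 1) * dirichlet_semigroup V E b r t (indicator ?I) x \<le> exp t / c * v x - 1"
    proof (rule dirichlet_semigroup_comparison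
        [where h = "\<lambda>s x. exp s / c * v x - 1" and h' = "\<lambda>s x. exp s / c * v x" and M = 1, OF b])
      fix s :: real and y assume "y \<in> ?I"
      show "((\<lambda>s. exp s / c * v y - 1) has_real_derivative exp s / c * v y) (at s)"
        using c by (auto intro!: derivative_eq_intros)
      have "0 \<le> exp s / c * (v y + laplacian E v y)"
        using c v(2)[OF inV[OF \<open>y \<in> ?I\<close>]] by simp
      then show "0 \<le> exp s / c * v y + laplacian E (\<lambda>x. exp s / c * v x - 1) y"
        unfolding laplacian_diff laplacian_scale laplacian_const by (simp add: algebra_simps)
    next
      fix s :: real and y assume y: "y \<in> V" "y \<notin> ?I" "0 \<le> s"
      then have "v y \<ge> c" using r by fastforce
      then have "1 * c \<le> exp s * v y" using y c by (intro mult_mono) auto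
      then show "0 \<le> exp s / c * v y - 1" using c by (simp add: field_simps)
    qed (use c v(1) inV t x in \<open>auto simp: indicator_def\<close>)
    moreover have "dirichlet_semigroup V E b r t (indicator ?I) x \<le> A"
      unfolding A_def using r b t by (intro heat_kernel_mass_ge) auto
    ultimately show ?thesis by simp
  qed
  \<comment> \<open>If \<open>A < 1\<close>, the choice \<open>c = (a + 1) / (1 - A)\<close> in \<open>ge\<close> bounds the loss \<open>1 - A\<close> by
  \<open>(1 - A) * (a / (a + 1))\<close>, which is smaller than the loss itself.\<close>
  define a where "a = exp t * v x"
  have a: "a \<ge> 0" using v(1)[OF x] by (simp add: a_def)
  have "1 - A \<le> a / ((a + 1) / (1 - A))" using ge[of "(a + 1) / (1 - A)"] A a by (simp add: a_def)
  also have "\<dots> = (1 - A) * (a / (a + 1))" by simp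
  also have "\<dots> < (1 - A) * 1" using A a by (intro mult_strict_left_mono) auto
  finally show False by simp
qed

text \<open>
  The subsolution \<open>exp t * v x - 1\<close> of the heat equation is non-positive at time 0 and at most
  \<open>exp T\<close> up to time \<open>T\<close>, so \<open>exp T\<close> times the heat lost dominates it in every ball. At \<open>z\<close> and time
  \<open>T\<close> the loss is at least \<open>v z - exp (- T)\<close>, uniformly in the ball.
\<close>

lemma stochastically_incomplete_if_bounded_subsolution:
  assumes b: "b \<in> V"
    and v: "\<And>x. x \<in> V \<Longrightarrow> v x \<le> 1" "\<And>x. x \<in> V \<Longrightarrow> v x + laplacian E v x \<le> 0"
    and z: "z \<in> V" "0 < v z"
  shows "stochastically_incomplete V E b"
proof -
  \<comment> \<open>Any \<open>T > - ln (v z)\<close> makes the loss \<open>v z - exp (- T)\<close> positive.\<close>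
  define T where "T = 1 - ln (v z)"
  have "ln (v z) \<le> 0" using v(1)[OF z(1)] z(2) by simp
  then have T: "T > 0" by (simp add: T_def)
  have "exp (- T) = v z * exp (- 1)" using z(2) by (simp add: T_def exp_diff exp_minus field_simps)
  also have "\<dots> < v z * 1" using z(2) by (intro mult_strict_left_mono) auto
  finally have small: "exp (- T) < v z" by simp
  define c where "c = 1 + exp (- T) - v z"
  have c: "0 \<le> c" "c < 1"
    using small v(1)[OF z(1)] exp_gt_zero[of "- T"] unfolding c_def by linarith+
  have "(\<Sum>\<^sub>\<infinity>y\<in>V. heat_kernel V E b T z y) \<le> c"
  proof (rule heat_kernel_mass_le[OF b])
    fix r
    let ?I = "int_ball V E b r"
    have inV: "y \<in> V" if "y \<in> ?I" for y using that int_ball_subset by auto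
    have "exp T * dirichlet_semigroup V E b r T (indicator ?I) z \<le> (exp T + 1) - exp T * v z"
    proof (rule dirichlet_semigroup_comparison
        [where h = "\<lambda>s x. (exp T + 1) - exp s * v x" and h' = "\<lambda>s x. - (exp s * v x)" and M = 1, OF b])
      fix s :: real and y assume "y \<in> ?I"
      show "((\<lambda>s. (exp T + 1) - exp s * v y) has_real_derivative - (exp s * v y)) (at s)"
        by (auto intro!: derivative_eq_intros)
      have "exp s * (v y + laplacian E v y) \<le> 0"
        using v(2)[OF inV[OF \<open>y \<in> ?I\<close>]] by (simp add: mult_nonneg_nonpos)
      then show "0 \<le> - (exp s * v y) + laplacian E (\<lambda>x. (exp T + 1) - exp s * v x) y"
        unfolding laplacian_diff laplacian_scale laplacian_const by (simp add: algebra_simps)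
    next
      fix s :: real and y assume y: "y \<in> V" "0 \<le> s" "s \<le> T"
      have "exp s * v y \<le> exp s * 1" using v(1)[OF y(1)] by (intro mult_left_mono) auto
      also have "\<dots> \<le> exp T" using y by simp
      finally show "0 \<le> (exp T + 1) - exp s * v y" by simp
    qed (use v(1) inV T z in \<open>auto simp: indicator_def\<close>)
    also have "\<dots> = exp T * c" by (simp add: c_def algebra_simps exp_minus)
    finally show "dirichlet_semigroup V E b r T (indicator ?I) z \<le> c" by simp
  qed (use T c in auto)
  then show ?thesis unfolding stochastically_incomplete_def using c T z(1) by force
qed

end

section \<open>Radial functions on a model tree\<close>

text \<open>
  Cutting out loops; the reachability of all vertices of the path is what later shows that the path
  avoids a given vertex.
\<close>

lemma rtranclp_imp_simple_path:
  assumes "R\<^sup>*\<^sup>* p q"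
  shows "\<exists>xs. xs \<noteq> [] \<and> distinct xs \<and> successively R xs \<and> hd xs = p \<and> last xs = q \<and>
    (\<forall>z\<in>set xs. R\<^sup>*\<^sup>* p z)"
  using assms
proof (induction rule: converse_rtranclp_induct)
  case base
  show ?case by (intro exI[of _ "[q]"]) auto
next
  case (step p z)
  then obtain xs where xs: "xs \<noteq> []" "distinct xs" "successively R xs" "hd xs = z" "last xs = q"
    "\<forall>u\<in>set xs. R\<^sup>*\<^sup>* z u" by blast
  have reach: "R\<^sup>*\<^sup>* p u" if "u \<in> set xs" for u
    using xs(6) that step(1) converse_rtranclp_into_rtranclp by metis
  show ?case
  proof (cases "p \<in> set xs")
    case True
    then obtain us vs where "xs = us @ p # vs" by (meson split_list)
    then show ?thesis using xs reach
      by (intro exI[of _ "p # vs"]) (auto simp: successively_append_iff)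
  next
    case False
    then show ?thesis using xs reach step(1)
      by (intro exI[of _ "p # xs"]) (auto simp: successively_Cons)
  qed
qed

locale rooted_model_tree =
  fixes V :: "'a set" and E :: "'a \<Rightarrow> 'a \<Rightarrow> bool" and x0 :: 'a and m :: "nat \<Rightarrow> nat"
  assumes model: "model_tree V E x0 m"

sublocale rooted_model_tree \<subseteq> lf_connected_graph V E
  using model by unfold_locales (auto simp: model_tree_def graph_tree_def)

context rooted_model_tree
begin

abbreviation depth :: "'a \<Rightarrow> nat" where
  "depth x \<equiv> graph_dist E x x0"

abbreviation branching :: "nat \<Rightarrow> nat" where
  "branching \<equiv> branching_number m"

lemma root_in_V: "x0 \<in> V"
  using model by (simp add: model_tree_def)

lemma no_cycle: "\<not> graph_cycle E xs"
  using model by (auto simp: model_tree_def graph_tree_def)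

lemma depth_neighbour_le: "E x y \<Longrightarrow> depth y \<le> Suc (depth x)"
  using graph_dist_neighbour_le[OF E_sym root_in_V] .

text \<open>
  A geodesic to the root has strictly decreasing depth, so all its vertices after the first are
  closer to the root than \<open>x\<close>.
\<close>

lemma reaches_root_avoiding:
  assumes "y \<in> V" "y \<noteq> x" "depth y \<le> depth x"
  shows "(\<lambda>u w. E u w \<and> u \<noteq> x \<and> w \<noteq> x)\<^sup>*\<^sup>* y x0"
  using assms
proof (induction "depth y" arbitrary: y)
  case 0
  then show ?case using graph_dist_eq_0[OF _ root_in_V] by simp
next
  case (Suc k)
  obtain z where z: "E y z" "depth z = k"
    using closer_neighbour_exists[OF Suc.prems(1) root_in_V] Suc.hyps(2) by metis
  have "z \<noteq> x" "z \<in> V" using z Suc E_in_V by auto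
  then show ?case using Suc.hyps(1)[of z] z Suc.prems Suc.hyps(2)
    by (auto intro!: converse_rtranclp_into_rtranclp[of _ y z x0])
qed

text \<open>
  Two distinct such neighbours would both be joined to the root by paths avoiding \<open>x\<close>, hence to each
  other, and \<open>x\<close> would close a simple path between them to a cycle. As \<open>p\<close> may have the same depth
  as \<open>x\<close>, edges within a sphere are excluded too.
\<close>

lemma parent_unique:
  assumes p: "E x p" "depth p \<le> depth x" and q: "E x q" "depth q \<le> depth x"
  shows "p = q"
proof (rule ccontr)
  assume "p \<noteq> q"
  define R where "R u w \<longleftrightarrow> E u w \<and> u \<noteq> x \<and> w \<noteq> x" for u w
  have "symp R" using E_sym by (auto simp: R_def symp_def)
  have ne: "p \<noteq> x" "q \<noteq> x" using p q E_irrefl by auto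
  have p_root: "R\<^sup>*\<^sup>* p x0" and q_root: "R\<^sup>*\<^sup>* q x0"
    using reaches_root_avoiding[of p x] reaches_root_avoiding[of q x] p q ne E_in_V
    unfolding R_def by auto
  have "R\<^sup>*\<^sup>* p q"
    using p_root sympD[OF symp_rtranclp[OF \<open>symp R\<close>] q_root] by (rule rtranclp_trans)
  then obtain xs where xs: "xs \<noteq> []" "distinct xs" "successively R xs" "hd xs = p" "last xs = q"
    "\<forall>z\<in>set xs. R\<^sup>*\<^sup>* p z"
    using rtranclp_imp_simple_path[of R p q] by blast
  have "z \<noteq> x" if "R\<^sup>*\<^sup>* p z" for z
    using that by (induction rule: rtranclp_induct) (auto simp: R_def ne)
  then have "x \<notin> set xs" using xs(6) by blast
  moreover have "successively E xs" using xs(3) by (rule successively_mono) (auto simp: R_def)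
  moreover have "length xs \<ge> 2" using xs \<open>p \<noteq> q\<close> by (cases xs; cases "tl xs") auto
  ultimately have "graph_cycle E (x # xs)"
    using xs(1,2,4,5) p(1) E_sym[OF q(1)] by (simp add: graph_cycle_def successively_Cons)
  then show False using no_cycle by blast
qed

lemma neighbours_root: "{y. E x0 y} = {y. E x0 y \<and> depth y = Suc 0}"
proof -
  have "depth y = Suc 0" if "E x0 y" for y
  proof -
    have "depth y \<noteq> 0" using that E_irrefl E_in_V graph_dist_eq_0[OF _ root_in_V] by metis
    then show ?thesis using depth_neighbour_le[OF that] by simp
  qed
  then show ?thesis by auto
qed

lemma neighbours_non_root:
  assumes "x \<in> V" "depth x = Suc k"
  obtains p where "depth p = k" "{y. E x y} = insert p {y. E x y \<and> depth y = Suc (depth x)}"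
proof -
  obtain p where p: "E x p" "depth p = k"
    using closer_neighbour_exists[OF assms(1) root_in_V assms(2)] by blast
  have "y = p \<or> depth y = Suc (depth x)" if "E x y" for y
    using parent_unique[OF that _ p(1)] p assms depth_neighbour_le[OF that] by linarith
  then show ?thesis using that[of p] p by blast
qed

lemma card_children:
  assumes "x \<in> V"
  shows "card {y. E x y \<and> depth y = Suc (depth x)} = branching (depth x)"
proof -
  have val: "card {y. E x y} = m (depth x)"
    using model assms by (auto simp: model_tree_def valence_def)
  show ?thesis
  proof (cases "depth x")
    case 0
    then have "x = x0" using graph_dist_eq_0[OF assms root_in_V] by simp
    then show ?thesis using val neighbours_root by (simp add: branching_number_def)
  next
    case (Suc k)
    obtain p where p: "depth p = k" "{y. E x y} = insert p {y. E x y \<and> depth y = Suc (depth x)}"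
      using neighbours_non_root[OF assms Suc] .
    have "finite {y. E x y \<and> depth y = Suc (depth x)}"
      by (rule finite_subset[OF _ finite_neighbours[of x]]) auto
    then have "card {y. E x y} = Suc (card {y. E x y \<and> depth y = Suc (depth x)})"
      unfolding p(2) using p(1) Suc by (subst card_insert_disjoint) auto
    then show ?thesis using val Suc by (simp add: branching_number_def)
  qed
qed

text \<open>
  Balls are finite and \<open>V\<close> is infinite, so some vertex has depth at least \<open>k\<close>, and depth drops by
  one at a time on the way to the root.
\<close>

lemma sphere_nonempty: "\<exists>x\<in>V. depth x = k"
proof -
  have "\<not> V \<subseteq> graph_ball V E x0 k"
    using finite_graph_ball[OF root_in_V] model by (meson finite_subset model_tree_def)
  then obtain x where "x \<in> V" "x \<notin> graph_ball V E x0 k" by blast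
  then have "x \<in> V" "k \<le> depth x" by (simp_all add: graph_ball_def)
  then show ?thesis
  proof (induction "depth x - k" arbitrary: x)
    case 0
    then have "depth x = k" by simp
    then show ?case using 0 by blast
  next
    case (Suc j)
    then have "depth x = Suc (k + j)" by linarith
    then obtain y where "E x y" "depth y = k + j"
      using closer_neighbour_exists[OF Suc.prems(1) root_in_V] by metis
    then show ?case using Suc.hyps(1)[of y] E_in_V by simp
  qed
qed

lemma branching_pos: "0 < branching k"
proof -
  obtain y where y: "y \<in> V" "depth y = Suc k" using sphere_nonempty by blast
  then obtain x where x: "E y x" "depth x = k" using closer_neighbour_exists root_in_V by metis
  then have "y \<in> {y. E x y \<and> depth y = Suc (depth x)}" using y E_sym by simp
  moreover have "finite {y. E x y \<and> depth y = Suc (depth x)}"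
    by (rule finite_subset[OF _ finite_neighbours[of x]]) auto
  ultimately have "0 < card {y. E x y \<and> depth y = Suc (depth x)}"
    by (auto simp: card_gt_0_iff)
  then show ?thesis using card_children[of x] x E_in_V by auto
qed

lemma laplacian_radial:
  assumes "x \<in> V"
  shows "laplacian E (\<lambda>x. g (depth x)) x =
    (if depth x = 0 then 0 else g (depth x) - g (depth x - 1))
      + real (branching (depth x)) * (g (depth x) - g (Suc (depth x)))"
proof -
  let ?C = "{y. E x y \<and> depth y = Suc (depth x)}"
  have fin: "finite ?C" by (rule finite_subset[OF _ finite_neighbours[of x]]) auto
  have C: "(\<Sum>y\<in>?C. g (depth x) - g (depth y)) =
      real (branching (depth x)) * (g (depth x) - g (Suc (depth x)))"
    by (simp add: card_children[OF assms])
  show ?thesis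
  proof (cases "depth x")
    case 0
    then have "x = x0" using graph_dist_eq_0[OF assms root_in_V] by simp
    then have "{y. E x y} = ?C" using neighbours_root 0 by simp
    then show ?thesis unfolding laplacian_def using C 0 by simp
  next
    case (Suc k)
    obtain p where p: "depth p = k" "{y. E x y} = insert p ?C"
      using neighbours_non_root[OF assms Suc] .
    have "p \<notin> ?C" using p(1) Suc by auto
    then have "laplacian E (\<lambda>x. g (depth x)) x =
        g (depth x) - g (depth p) + (\<Sum>y\<in>?C. g (depth x) - g (depth y))"
      unfolding laplacian_def p(2) using fin by simp
    then show ?thesis using C Suc p(1) by simp
  qed
qed

end

section \<open>The radial eigenfunction\<close>

text \<open>
  The solution of \<open>\<Delta> v = - v\<close> among radial functions, normalised by \<open>v 0 = 1\<close>; the recursion is the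
  equation at depth \<open>r\<close> solved for the value at depth \<open>r + 1\<close>.
\<close>

fun radial_eigenfunction :: "(nat \<Rightarrow> nat) \<Rightarrow> nat \<Rightarrow> real" where
  "radial_eigenfunction n 0 = 1"
| "radial_eigenfunction n (Suc 0) = 1 + 1 / real (n 0)"
| "radial_eigenfunction n (Suc (Suc r)) = radial_eigenfunction n (Suc r)
    + (radial_eigenfunction n (Suc r) + (radial_eigenfunction n (Suc r) - radial_eigenfunction n r))
      / real (n (Suc r))"

lemma radial_eigenfunction_mono_pos:
  "1 \<le> radial_eigenfunction n r \<and> radial_eigenfunction n r \<le> radial_eigenfunction n (Suc r)"
proof (induction r)
  case (Suc r)
  then have "0 \<le> (radial_eigenfunction n (Suc r) + (radial_eigenfunction n (Suc r) - radial_eigenfunction n r))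
      / real (n (Suc r))" by (intro divide_nonneg_nonneg) auto
  then show ?case using Suc by simp
qed simp

text \<open>
  The increment at \<open>r\<close> is the value at \<open>r\<close> plus the previous increment, divided by \<open>n r\<close>. The value
  is at least 1, and the previous increment lies between 0 and the value.
\<close>

lemma radial_eigenfunction_step:
  "1 / real (n r) \<le> radial_eigenfunction n (Suc r) - radial_eigenfunction n r"
  "radial_eigenfunction n (Suc r) \<le> radial_eigenfunction n r * (1 + 2 * (1 / real (n r)))"
proof -
  let ?g = "radial_eigenfunction n"
  have "1 / real (n r) \<le> ?g (Suc r) - ?g r \<and> ?g (Suc r) \<le> ?g r * (1 + 2 * (1 / real (n r)))"
  proof (cases r)
    case (Suc k)
    have g: "1 \<le> ?g k" "?g k \<le> ?g (Suc k)"
      using radial_eigenfunction_mono_pos[of n k] by auto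
    have "1 / real (n r) \<le> (?g (Suc k) + (?g (Suc k) - ?g k)) / real (n r)"
      using g by (intro divide_right_mono) auto
    moreover have "(?g (Suc k) + (?g (Suc k) - ?g k)) / real (n r) \<le> (2 * ?g (Suc k)) / real (n r)"
      using g by (intro divide_right_mono) auto
    ultimately show ?thesis using Suc by (simp add: algebra_simps)
  qed (simp add: divide_right_mono)
  then show "1 / real (n r) \<le> ?g (Suc r) - ?g r" "?g (Suc r) \<le> ?g r * (1 + 2 * (1 / real (n r)))"
    by auto
qed

lemma radial_eigenfunction_ge: "(\<Sum>r<R. 1 / real (n r)) \<le> radial_eigenfunction n R"
proof (induction R)
  case (Suc R)
  then show ?case using radial_eigenfunction_step(1)[of n R] by simp
qed simp

lemma radial_eigenfunction_le: "radial_eigenfunction n R \<le> exp (2 * (\<Sum>r<R. 1 / real (n r)))"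
proof (induction R)
  case (Suc R)
  have "radial_eigenfunction n (Suc R) \<le> radial_eigenfunction n R * (1 + 2 * (1 / real (n R)))"
    by (rule radial_eigenfunction_step)
  also have "\<dots> \<le> exp (2 * (\<Sum>r<R. 1 / real (n r))) * exp (2 * (1 / real (n R)))"
    by (intro mult_mono Suc exp_ge_add_one_self) auto
  finally show ?case by (simp add: exp_add[symmetric] algebra_simps)
qed simp

lemma (in rooted_model_tree) laplacian_radial_eigenfunction:
  assumes "x \<in> V"
  shows "laplacian E (\<lambda>x. radial_eigenfunction branching (depth x)) x =
    - radial_eigenfunction branching (depth x)"
proof (cases "depth x")
  case 0
  then show ?thesis using branching_pos[of 0] by (simp add: laplacian_radial[OF assms])
next
  case (Suc k)
  then show ?thesis using branching_pos[of "Suc k"] by (simp add: laplacian_radial[OF assms])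
qed

lemma suminf_ennreal_eq_infinity_iff:
  fixes f :: "nat \<Rightarrow> real"
  assumes "\<And>r. 0 \<le> f r"
  shows "(\<Sum>r. ennreal (f r)) = \<infinity> \<longleftrightarrow> \<not> summable f"
proof
  assume "(\<Sum>r. ennreal (f r)) = \<infinity>"
  then show "\<not> summable f" using suminf_ennreal2[OF assms] by force
next
  assume "\<not> summable f"
  then show "(\<Sum>r. ennreal (f r)) = \<infinity>"
    using summable_suminf_not_top[of f] assms unfolding infinity_ennreal_def by blast
qed

theorem corollary3p10:
  fixes V :: "'a set" and E :: "'a \<Rightarrow> 'a \<Rightarrow> bool" and x0 b :: 'a and m :: "nat \<Rightarrow> nat"
  assumes "model_tree V E x0 m" and "b \<in> V"
  shows "stochastically_complete V E b \<longleftrightarrow>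
    (\<Sum>r. ennreal (1 / real (branching_number m r))) = \<infinity>"
proof -
  interpret rooted_model_tree V E x0 m by unfold_locales fact
  let ?g = "radial_eigenfunction branching" and ?a = "\<lambda>r. 1 / real (branching r)"
  have g1: "1 \<le> ?g r" for r using radial_eigenfunction_mono_pos by blast
  have mono: "mono ?g" using radial_eigenfunction_mono_pos by (auto simp: mono_iff_le_Suc)
  have "stochastically_complete V E b \<longleftrightarrow> \<not> summable ?a"
  proof
    assume not_summable: "\<not> summable ?a"
    show "stochastically_complete V E b"
    proof (rule stochastically_complete_if_exhausting_supersolution
        [where v = "\<lambda>x. ?g (depth x)", OF assms(2)])
      fix c
      obtain R where "c \<le> (\<Sum>r<R. ?a r)"
        using not_summable summableI_nonneg_bounded[of ?a c] linorder_le_cases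
        by (metis divide_nonneg_nonneg of_nat_0_le_iff zero_le_one)
      then have R: "c \<le> ?g R" using radial_eigenfunction_ge[of branching R] by linarith
      have "{x \<in> V. ?g (depth x) < c} \<subseteq> graph_ball V E x0 R"
        using R monoD[OF mono] by (auto simp: graph_ball_def) (meson linorder_le_cases not_le order_trans)
      then show "finite {x \<in> V. ?g (depth x) < c}"
        using finite_graph_ball[OF root_in_V] finite_subset by blast
    qed (use g1 in \<open>auto simp: laplacian_radial_eigenfunction intro: order_trans[OF zero_le_one]\<close>)
  next
    assume complete: "stochastically_complete V E b"
    show "\<not> summable ?a"
    proof
      assume summable: "summable ?a"
      define K where "K = exp (2 * suminf ?a)"
      have K: "K > 0" by (simp add: K_def)
      have gK: "?g r \<le> K" for r
        using radial_eigenfunction_le[of branching r] sum_le_suminf[OF summable, of "{..<r}"]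
        by (force simp: K_def intro: order_trans)
      have "stochastically_incomplete V E b"
      proof (rule stochastically_incomplete_if_bounded_subsolution
          [where v = "\<lambda>x. (1 / K) * ?g (depth x)" and z = x0, OF assms(2)])
        fix x assume "x \<in> V"
        then show "(1 / K) * ?g (depth x) + laplacian E (\<lambda>x. (1 / K) * ?g (depth x)) x \<le> 0"
          unfolding laplacian_scale by (simp add: laplacian_radial_eigenfunction)
      qed (use K gK root_in_V in \<open>auto simp: field_simps\<close>)
      then show False using complete by (simp add: stochastically_complete_def)
    qed
  qed
  moreover have "(\<Sum>r. ennreal (?a r)) = \<infinity> \<longleftrightarrow> \<not> summable ?a"
    by (rule suminf_ennreal_eq_infinity_iff) simp
  ultimately show ?thesis by (rule trans[OF _ sym])
qed

end
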